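(* For all constants $\alpha\ge1$ and $\beta\ge1$, there is an unrelated-machines instance with interval uncertainty, two machines and one job (i.e. an interval uncertainty set $\mathcal U$ together with a predicted scenario $\hat q\in\mathcal U$) such that no randomized algorithm is both $\alpha$-consistent and $\beta$-robust on it; that is, there is no random schedule $\mathcal S$ with $$\mathbb E[C_{\max}(\mathcal S,\hat q)]\le\alpha\,\mathrm{OPT}(\hat q)\quad\text{and}\quad \mathbb E[C_{\max}(\mathcal S,q)]\le\beta\,\mathrm{OPT}^{\mathrm{rob}}(\mathcal U)\ \text{ for all } q\in\mathcal U.$$
   Context: There are $m$ machines and $n$ jobs. A scenario is a matrix $q\in\mathbb R_{\ge0}^{m\times n}$, where $q_{i,j}$ is the processing time of job $j$ on machine $i$ (unrelated machines). A schedule is a partition $\mathcal S=(S_1,\dots,S_m)$ of $[n]$ (parts may be empty), and $C_{\max}(\mathcal S,q)=\max_{i}\sum_{j\in S_i}q_{i,j}$. $\mathrm{OPT}(q)=\min_{\mathcal S}C_{\max}(\mathcal S,q)$ and $\mathrm{OPT}^{\mathrm{rob}}(\mathcal U)=\min_{\mathcal S}\max_{q\in\mathcal U}C_{\max}(\mathcal S,q)$, minima over deterministic schedules. Interval uncertainty on unrelated machines: for given $0\le q^-_{i,j}\le q^+_{i,j}$, $\mathcal U=\{q: q_{i,j}\in[q^-_{i,j},q^+_{i,j}]\ \forall i,j\}$. A randomized algorithm returns, on input $(\mathcal U,\hat q)$, a random schedule (a probability distribution over schedules); its consistency and robustness are measured in expectation, with the scenario $q$ chosen independently of the algorithm's randomness.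 *)

theory Defs
  imports "HOL-Analysis.Analysis" "HOL-Probability.Probability"
begin

text \<open>
  Machines are the elements of the finite type \<open>'m\<close> and jobs those of \<open>'n\<close>. In a scenario
  \<open>q :: real ^ 'n ^ 'm\<close>, the entry \<open>q $ i $ j\<close> is the processing time of job \<open>j\<close> on machine \<open>i\<close>.
\<close>

definition is_schedule :: "('m::finite \<Rightarrow> 'n::finite set) \<Rightarrow> bool" where
  "is_schedule S \<longleftrightarrow> disjoint_family S \<and> (\<Union>i. S i) = UNIV"

definition C_max :: "('m::finite \<Rightarrow> 'n::finite set) \<Rightarrow> real ^ 'n ^ 'm \<Rightarrow> real" where
  "C_max S q = (MAX i. \<Sum>j\<in>S i. q $ i $ j)"

definition OPT :: "real ^ 'n::finite ^ 'm::finite \<Rightarrow> real" where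
  "OPT q = Min ((\<lambda>S. C_max S q) ` {S. is_schedule S})"

text \<open>
  The inner maximum over \<open>U\<close> is written as a supremum. It is attained whenever \<open>U\<close> is nonempty
  and compact, in particular for interval uncertainty sets.
\<close>

definition OPT_rob :: "(real ^ 'n::finite ^ 'm::finite) set \<Rightarrow> real" where
  "OPT_rob U = Min ((\<lambda>S. SUP q\<in>U. C_max S q) ` {S. is_schedule S})"

definition interval_uncertainty :: "(real ^ 'n::finite ^ 'm::finite) set \<Rightarrow> bool" where
  "interval_uncertainty U \<longleftrightarrow>
     (\<exists>lo hi. (\<forall>i j. 0 \<le> lo $ i $ j \<and> lo $ i $ j \<le> hi $ i $ j) \<and>
        U = {q. \<forall>i j. q $ i $ j \<in> {lo $ i $ j .. hi $ i $ j}})"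

definition random_schedule :: "('m::finite \<Rightarrow> 'n::finite set) pmf \<Rightarrow> bool" where
  "random_schedule P \<longleftrightarrow> (\<forall>S\<in>set_pmf P. is_schedule S)"

definition expected_C_max ::
    "('m::finite \<Rightarrow> 'n::finite set) pmf \<Rightarrow> real ^ 'n ^ 'm \<Rightarrow> real" where
  "expected_C_max P q = measure_pmf.expectation P (\<lambda>S. C_max S q)"

end

theory Submission
  imports Defs
begin

text \<open>
  The job takes time 1 on machine 2, and on machine 1 any time in \<open>[0, \<beta> + 1]\<close>, predicted to be 0.
  As the predicted optimum is 0, any finite consistency forces the job onto machine 1 almost surely,
  whose worst case \<open>\<beta> + 1\<close> exceeds \<open>\<beta>\<close> times the robust optimum 1.
\<close>

definition single_schedule :: "'m::finite \<Rightarrow> 'm \<Rightarrow> 'n::finite set" where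
  "single_schedule k = (\<lambda>i. if i = k then UNIV else {})"

lemma is_schedule_single_schedule: "is_schedule (single_schedule k)"
  by (auto simp: is_schedule_def single_schedule_def disjoint_family_on_def)

text \<open>The type \<open>1\<close> has a single element, so a nonempty part contains the only job
  and disjointness empties all others. A random schedule thus amounts to a random choice of
  machine.\<close>

lemma is_schedule_one_jobE:
  fixes S :: "'m::finite \<Rightarrow> 1 set"
  assumes "is_schedule S"
  obtains k where "S = single_schedule k"
proof -
  obtain k where k: "1 \<in> S k"
    using assms by (auto simp: is_schedule_def)
  have "S i = single_schedule k i" for i
  proof (cases "i = k")
    case True
    then show ?thesis
      using k by (auto simp: single_schedule_def)
  next
    case False
    then have "S i \<inter> S k = {}"
      using assms by (auto simp: is_schedule_def disjoint_family_on_def)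
    then have "S i = {}"
      using k by (metis disjoint_iff ex_in_conv num1_eq1)
    then show ?thesis
      using False by (simp add: single_schedule_def)
  qed
  then have "S = single_schedule k" ..
  then show thesis by (rule that)
qed

text \<open>Every other machine is idle with load 0, which the sign condition keeps from exceeding
  the load of \<open>k\<close>.\<close>

lemma C_max_single_schedule:
  fixes q :: "real ^ 1 ^ 'm::finite"
  assumes "0 \<le> q $ k $ 1"
  shows "C_max (single_schedule k) q = q $ k $ 1"
  unfolding C_max_def
  by (rule Max_eqI) (use assms in \<open>auto simp: single_schedule_def image_iff intro!: exI[of _ k]\<close>)

lemma OPT_le_C_max: "is_schedule S \<Longrightarrow> OPT q \<le> C_max S q"
  by (simp add: OPT_def)

lemma OPT_rob_le_SUP: "is_schedule S \<Longrightarrow> OPT_rob U \<le> (SUP q\<in>U. C_max S q)"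
  by (simp add: OPT_rob_def)

text \<open>A nonnegative variable with nonpositive mean vanishes almost surely, which for a
  \<open>pmf\<close> means on its whole support. This turns a bound on the average into a fact about
  each schedule that can occur.\<close>

lemma expected_C_max_le_0_imp:
  assumes "expected_C_max P q \<le> 0" and "\<And>S. S \<in> set_pmf P \<Longrightarrow> 0 \<le> C_max S q"
    and "S \<in> set_pmf P"
  shows "C_max S q = 0"
proof -
  have nonneg: "AE S in measure_pmf P. 0 \<le> C_max S q"
    using assms(2) by (simp add: AE_measure_pmf_iff)
  have "measure_pmf.expectation P (\<lambda>S. C_max S q) = 0"
    using assms(1) integral_nonneg_AE[OF nonneg] by (simp add: expected_C_max_def)
  then have "AE S in measure_pmf P. C_max S q = 0"
    \<comment> \<open>Integrability holds because the type of \<open>S\<close> is finite, so the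
      support of \<open>P\<close> is finite.\<close>
    using integral_nonneg_eq_0_iff_AE[OF _ nonneg] by (simp add: integrable_measure_pmf_finite)
  then show ?thesis
    using assms(3) by (simp add: AE_measure_pmf_iff)
qed

lemma expected_C_max_const:
  assumes "\<And>S. S \<in> set_pmf P \<Longrightarrow> C_max S q = c"
  shows "expected_C_max P q = c"
proof -
  have "expected_C_max P q = measure_pmf.expectation P (\<lambda>_. c)"
    unfolding expected_C_max_def
    by (rule integral_cong_AE) (use assms in \<open>auto simp: AE_measure_pmf_iff\<close>)
  then show ?thesis by simp
qed

theorem theorem6:
  fixes \<alpha> \<beta> :: real
  assumes "\<alpha> \<ge> 1" and "\<beta> \<ge> 1"
  shows "\<exists>(U :: (real ^ 1 ^ 2) set) qhat.
    interval_uncertainty U \<and> qhat \<in> U \<and>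
    \<not> (\<exists>P :: (2 \<Rightarrow> 1 set) pmf. random_schedule P \<and>
         expected_C_max P qhat \<le> \<alpha> * OPT qhat \<and>
         (\<forall>q\<in>U. expected_C_max P q \<le> \<beta> * OPT_rob U))"
proof -
  \<comment> \<open>\<open>lo\<close> serves as the prediction and \<open>hi\<close> as the
    adversarial scenario. On machine 2 the bounds coincide, so its cost is certain; on machine 1 any
    upper bound above \<beta> would do.\<close>
  define lo hi :: "real ^ 1 ^ 2" where
    "lo = (\<chi> i j. if i = 1 then 0 else 1)" and
    "hi = (\<chi> i j. if i = 1 then \<beta> + 1 else 1)"
  define U where "U = {q. \<forall>i j. q $ i $ j \<in> {lo $ i $ j .. hi $ i $ j}}"
  have le: "0 \<le> lo $ i $ j \<and> lo $ i $ j \<le> hi $ i $ j" for i j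
    using assms(2) by (simp add: lo_def hi_def)
  have U: "interval_uncertainty U"
    unfolding interval_uncertainty_def U_def using le by blast
  have lo_U: "lo \<in> U" and hi_U: "hi \<in> U"
    using le by (auto simp: U_def)
  have OPT: "OPT lo \<le> 0"
    using OPT_le_C_max[OF is_schedule_single_schedule, of lo 1]
    by (simp add: C_max_single_schedule lo_def)
  have machine2: "C_max (single_schedule 2) q = 1" if "q \<in> U" for q
  proof -
    have "q $ 2 $ 1 \<in> {lo $ 2 $ 1 .. hi $ 2 $ 1}"
      using that unfolding U_def by blast
    then have "q $ 2 $ 1 = 1"
      by (simp add: lo_def hi_def)
    then show ?thesis
      by (simp add: C_max_single_schedule)
  qed
  \<comment> \<open>The safe choice, machine 2, bounds the robust optimum. Evaluating the supremum
    of a constant requires \<open>U\<close> to be nonempty, which \<open>lo_U\<close>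
    provides.\<close>
  have "(SUP q\<in>U. C_max (single_schedule 2) q) = (SUP q\<in>U. 1)"
    using machine2 by (intro SUP_cong) auto
  also have "\<dots> = 1"
    using lo_U by (intro cSUP_const) auto
  finally have rob: "OPT_rob U \<le> 1"
    using OPT_rob_le_SUP[OF is_schedule_single_schedule, of U 2] by simp
  have False if P: "random_schedule P" "expected_C_max P lo \<le> \<alpha> * OPT lo"
    "\<forall>q\<in>U. expected_C_max P q \<le> \<beta> * OPT_rob U" for P :: "(2 \<Rightarrow> 1 set) pmf"
  proof -
    have single: "\<exists>k. S = single_schedule k" if "S \<in> set_pmf P" for S
      using that P(1) is_schedule_one_jobE unfolding random_schedule_def by metis
    have nonneg: "0 \<le> C_max S lo" if "S \<in> set_pmf P" for S
      using single[OF that] le by (auto simp: C_max_single_schedule)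
    \<comment> \<open>A multiplicative guarantee gives no slack over a zero optimum, however large
      \<alpha> is.\<close>
    have "\<alpha> * OPT lo \<le> 0"
      using assms(1) OPT by (simp add: mult_nonneg_nonpos)
    then have consistent: "expected_C_max P lo \<le> 0"
      using P(2) by simp
    have machine1: "S = single_schedule 1" if S: "S \<in> set_pmf P" for S
    proof -
      obtain k where k: "S = single_schedule k"
        using single[OF S] by blast
      have "C_max S lo = 0"
        using expected_C_max_le_0_imp[OF consistent nonneg S] .
      then have "k \<noteq> 2"
        using machine2[OF lo_U] k by auto
      then show ?thesis
        using k exhaust_2[of k] by auto
    qed
    \<comment> \<open>\<open>P\<close> is now concentrated on one schedule, so randomization no
      longer softens the cost under \<open>hi\<close>.\<close>
    have "expected_C_max P hi = \<beta> + 1"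
    proof (rule expected_C_max_const)
      show "C_max S hi = \<beta> + 1" if "S \<in> set_pmf P" for S
        using machine1[OF that] assms(2) by (simp add: C_max_single_schedule hi_def)
    qed
    moreover have "expected_C_max P hi \<le> \<beta> * OPT_rob U"
      using P(3) hi_U by blast
    moreover have "\<beta> * OPT_rob U \<le> \<beta> * 1"
      using assms(2) rob by (intro mult_left_mono) auto
    ultimately show False by simp
  qed
  then show ?thesis
    using U lo_U by blast
qed

end
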